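(* Let $m\ge 1$. For each $\mu$ with $0\le\mu\le 1$, the function $\widetilde C_\mu:[0,1]\to[0,1]$, $\widetilde C_\mu(s)=\mu\sqrt{1-s^2}$, is a moderation incentive, with moderation potential $$\chi_\mu(\lambda)=\sqrt{\mu^2+|\lambda|^2},\qquad \lambda\in\mathbb{R}^m.$$ If $\mu>0$, then $\chi_\mu\in\mathcal{C}^1(\mathbb{R}^m,\mathbb{R}^+)$; $\chi_0$ is continuously differentiable everywhere except at the origin, where the equation determining the optimal control value is completely degenerate (i.e. for $\lambda=0$ and $\mu=0$ the equation $|u|\,|\lambda|+\widetilde C_0(|u|)=\chi_0(\lambda)$ is satisfied by every $u$ in the closed unit ball of $\mathbb{R}^m$). The quadratic polynomial $\widetilde C_{\rm q}(s)=\frac12(1-s^2)$ on $[0,1]$ is a moderation incentive, with moderation potential $$\chi_{\rm q}(\lambda)=\begin{cases}\frac12\left(1+|\lambda|^2\right), & |\lambda|\le 1,\\ |\lambda|, & |\lambda|>1,\end{cases}\qquad \lambda\in\mathbb{R}^m,$$ and $\chi_{\rm q}\in\mathcal{C}^1(\mathbb{R}^m,\mathbb{R}^+)$.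
   Context: $\mathbb{R}^+=(0,\infty)$ and $|\cdot|$ is the Euclidean norm. Moderation incentive: a continuous function $\widetilde C:[0,1]\to[0,1]$, differentiable on $(0,1)$, with $\widetilde C(1)=0$, such that there is a unique non-decreasing continuous function $\sigma:\mathbb{R}^+\to(0,1]$, differentiable on $\sigma^{-1}((0,1))$, satisfying $$\sigma(s)\,s+\widetilde C(\sigma(s))=\widetilde\chi(s):=\max_{0\le \varsigma\le 1}\big(\varsigma\, s+\widetilde C(\varsigma)\big)\quad\text{for all } s>0.$$ Its moderation potential on $\mathbb{R}^m$ is $\chi(\lambda):=\widetilde\chi(|\lambda|)$ (with $\widetilde\chi(0)$ given by the same maximum). The equation determining the magnitude of the optimal control $u$, $|u|\le1$, for a given $\lambda$ is $|u|\,|\lambda|+\widetilde C(|u|)=\chi(\lambda)$. *)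

theory Defs
  imports "HOL-Analysis.Analysis"
begin

text \<open>
  Functions on \<open>[0,1]\<close> and on \<open>(0,\<infinity>)\<close> are total functions on the reals;
  only their values on the relevant interval are ever used.
\<close>

text \<open>
  The maximum is written as a supremum; lemma \<open>max_value_attained\<close> below shows that
  it is attained whenever \<open>C\<close> is continuous on \<open>[0,1]\<close>.
\<close>

definition max_value :: "(real \<Rightarrow> real) \<Rightarrow> real \<Rightarrow> real" where
  "max_value C s = (SUP \<tau>\<in>{0..1}. \<tau> * s + C \<tau>)"

lemma max_value_attained:
  assumes "continuous_on {0..1} C"
  shows "\<exists>\<tau>\<in>{0..1}. max_value C s = \<tau> * s + C \<tau> \<and> (\<forall>\<rho>\<in>{0..1}. \<rho> * s + C \<rho> \<le> \<tau> * s + C \<tau>)"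
proof -
  have "continuous_on {0..1} (\<lambda>\<tau>. \<tau> * s + C \<tau>)"
    using assms by (intro continuous_intros)
  then obtain \<tau> where \<tau>: "\<tau> \<in> {0..1}" "\<forall>\<rho>\<in>{0..1}. \<rho> * s + C \<rho> \<le> \<tau> * s + C \<tau>"
    using continuous_attains_sup[of "{0..1::real}" "\<lambda>\<tau>. \<tau> * s + C \<tau>"] by auto
  then have "max_value C s = \<tau> * s + C \<tau>"
    unfolding max_value_def by (intro cSup_eq_maximum) auto
  with \<tau> show ?thesis by blast
qed

definition optimal_magnitude :: "(real \<Rightarrow> real) \<Rightarrow> (real \<Rightarrow> real) \<Rightarrow> bool" where
  "optimal_magnitude C \<sigma> \<longleftrightarrow>
     mono_on {0<..} \<sigma> \<and> continuous_on {0<..} \<sigma> \<and> \<sigma> ` {0<..} \<subseteq> {0<..1} \<and>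
     \<sigma> differentiable_on ({0<..} \<inter> \<sigma> -` {0<..<1}) \<and>
     (\<forall>s>0. \<sigma> s * s + C (\<sigma> s) = max_value C s)"

text \<open>Uniqueness is uniqueness as a function on \<open>(0,\<infinity>)\<close>.\<close>

definition moderation_incentive :: "(real \<Rightarrow> real) \<Rightarrow> bool" where
  "moderation_incentive C \<longleftrightarrow>
     continuous_on {0..1} C \<and> C ` {0..1} \<subseteq> {0..1} \<and> C differentiable_on {0<..<1} \<and> C 1 = 0 \<and>
     (\<exists>\<sigma>. optimal_magnitude C \<sigma> \<and>
        (\<forall>\<sigma>'. optimal_magnitude C \<sigma>' \<longrightarrow> (\<forall>s>0. \<sigma>' s = \<sigma> s)))"

definition moderation_potential :: "(real \<Rightarrow> real) \<Rightarrow> real ^ 'm \<Rightarrow> real" where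
  "moderation_potential C l = max_value C (norm l)"

definition control_equation :: "(real \<Rightarrow> real) \<Rightarrow> real ^ 'm \<Rightarrow> real ^ 'm \<Rightarrow> bool" where
  "control_equation C l u \<longleftrightarrow> norm u * norm l + C (norm u) = moderation_potential C l"

text \<open>Meant for open \<open>S\<close>; continuity of the derivative is with respect to the operator norm.\<close>

definition continuously_differentiable_on ::
    "('a::real_normed_vector \<Rightarrow> 'b::real_normed_vector) \<Rightarrow> 'a set \<Rightarrow> bool" where
  "continuously_differentiable_on f S \<longleftrightarrow>
     (\<exists>f' :: 'a \<Rightarrow> 'a \<Rightarrow>\<^sub>L 'b.
        (\<forall>x\<in>S. (f has_derivative blinfun_apply (f' x)) (at x)) \<and> continuous_on S f')"

definition C_mu :: "real \<Rightarrow> real \<Rightarrow> real" where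
  "C_mu \<mu> s = \<mu> * sqrt (1 - s\<^sup>2)"

definition chi_mu :: "real \<Rightarrow> real ^ 'm \<Rightarrow> real" where
  "chi_mu \<mu> l = sqrt (\<mu>\<^sup>2 + (norm l)\<^sup>2)"

definition C_q :: "real \<Rightarrow> real" where
  "C_q s = (1 - s\<^sup>2) / 2"

definition chi_q :: "real ^ 'm \<Rightarrow> real" where
  "chi_q l = (if norm l \<le> 1 then (1 + (norm l)\<^sup>2) / 2 else norm l)"

end

theory Submission
  imports Defs
begin

text \<open>
  The optimal control \<open>u\<close> for \<open>l\<close> is parallel to \<open>l\<close>, with \<open>norm u\<close> maximising
  \<open>\<tau> * norm l + C \<tau>\<close>, so the moderation potential \<open>\<chi>\<close> is the supremum over the unit ball of
  the functions \<open>u \<bullet> l + C (norm u)\<close>, which are affine in \<open>l\<close>, and an optimal \<open>u\<close> is a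
  subgradient of \<open>\<chi>\<close> at \<open>l\<close>
  (\<open>optimal_control_subgradient\<close>).  A function with a continuous selection of subgradients is
  continuously differentiable, the selection being its gradient
  (\<open>continuous_subgradient_imp_continuously_differentiable\<close>).  Hence regularity of the
  potentials reduces to the continuity of the optimal controls \<open>l / \<chi>\<^sub>\<mu> l\<close> and
  \<open>l / max 1 (norm l)\<close>, which treats the origin and the unit sphere, where the formula for
  \<open>\<chi>\<^sub>q\<close> changes, like all other points.  The one failure is \<open>\<mu> = 0\<close> at \<open>l = 0\<close>: all
  controls are optimal there, no continuous selection exists, and \<open>\<chi>\<^sub>0\<close> is the norm, which has
  a corner.

  It remains to maximise in one variable.  With \<open>r = sqrt (1 - \<rho>\<^sup>2)\<close>, Lagrange's identity
  \<open>(\<rho> s + \<mu> r)\<^sup>2 + (s r - \<mu> \<rho>)\<^sup>2 = \<mu>\<^sup>2 + s\<^sup>2\<close> gives the maximum \<open>sqrt (\<mu>\<^sup>2 + s\<^sup>2)\<close> in the first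
  family, attained for \<open>s > 0\<close> only at \<open>s / sqrt (\<mu>\<^sup>2 + s\<^sup>2)\<close>.  For the quadratic incentive,
  completing the square shows that the only maximiser is the projection \<open>min s 1\<close> of \<open>s\<close> to
  \<open>[0,1]\<close>.  Uniqueness of the maximiser at each \<open>s\<close> is what makes the function \<open>\<sigma>\<close> of a
  moderation incentive unique.
\<close>

section \<open>Maximisers\<close>

lemma max_value_eqI:
  assumes "\<tau> \<in> {0..1}" and "\<And>\<rho>. \<rho> \<in> {0..1} \<Longrightarrow> \<rho> * s + C \<rho> \<le> \<tau> * s + C \<tau>"
  shows "max_value C s = \<tau> * s + C \<tau>"
  unfolding max_value_def using assms by (intro cSup_eq_maximum) auto

lemma le_max_value:
  assumes "continuous_on {0..1} C" "\<rho> \<in> {0..1}"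
  shows "\<rho> * s + C \<rho> \<le> max_value C s"
  using max_value_attained[OF assms(1), of s] assms(2) by force

text \<open>
  The equation that a competing \<open>\<sigma>'\<close> must satisfy says that \<open>\<sigma>' s\<close> is a maximiser, so pointwise
  uniqueness of maximisers forces \<open>\<sigma>' s = \<sigma> s\<close>.
\<close>

lemma moderation_incentiveI:
  assumes C: "continuous_on {0..1} C" "C ` {0..1} \<subseteq> {0..1}" "C differentiable_on {0<..<1}" "C 1 = 0"
    and \<sigma>: "mono_on {0<..} \<sigma>" "continuous_on {0<..} \<sigma>" "\<sigma> ` {0<..} \<subseteq> {0<..1}"
      "\<sigma> differentiable_on ({0<..} \<inter> \<sigma> -` {0<..<1})"
    and max: "\<And>s. s > 0 \<Longrightarrow> \<sigma> s * s + C (\<sigma> s) = max_value C s"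
    and unique: "\<And>s \<rho>. s > 0 \<Longrightarrow> \<rho> \<in> {0..1} \<Longrightarrow> \<rho> * s + C \<rho> = max_value C s \<Longrightarrow> \<rho> = \<sigma> s"
  shows "moderation_incentive C"
proof -
  have "optimal_magnitude C \<sigma>"
    unfolding optimal_magnitude_def using \<sigma> max by blast
  moreover have "\<sigma>' s = \<sigma> s" if \<sigma>': "optimal_magnitude C \<sigma>'" and s: "s > 0" for \<sigma>' s
  proof (rule unique[OF s])
    have "\<sigma>' s \<in> {0<..1}" using \<sigma>' s unfolding optimal_magnitude_def by blast
    then show "\<sigma>' s \<in> {0..1}" by auto
    show "\<sigma>' s * s + C (\<sigma>' s) = max_value C s"
      using \<sigma>' s unfolding optimal_magnitude_def by blast
  qed
  ultimately show ?thesis unfolding moderation_incentive_def using C by blast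
qed

section \<open>Optimal controls as gradients\<close>

text \<open>
  Using the subgradient inequality at both ends of a segment gives
  \<open>0 \<le> f y - f x - g x \<bullet> (y - x) \<le> (g y - g x) \<bullet> (y - x)\<close>,
  and the last term is \<open>o(norm (y - x))\<close> because \<open>g\<close> is continuous.
\<close>

lemma continuous_subgradient_imp_continuously_differentiable:
  fixes f :: "'a::real_inner \<Rightarrow> real"
  assumes S: "open S" and g: "continuous_on S g"
    and sub: "\<And>x y. x \<in> S \<Longrightarrow> y \<in> S \<Longrightarrow> f x + g x \<bullet> (y - x) \<le> f y"
  shows "continuously_differentiable_on f S"
  unfolding continuously_differentiable_on_def
proof (intro exI conjI ballI)
  show "continuous_on S (\<lambda>x. blinfun_inner_right (g x))"
    by (intro bounded_linear.continuous_on[OF bounded_linear_blinfun_inner_right] g)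
  fix x assume x: "x \<in> S"
  have "(f has_derivative (\<lambda>h. g x \<bullet> h)) (at x)"
    unfolding has_derivative_at_alt
  proof (intro conjI allI impI)
    show "bounded_linear (\<lambda>h. g x \<bullet> h)" by (rule bounded_linear_inner_right)
    fix e :: real assume e: "e > 0"
    obtain d where d: "d > 0" "\<And>y. y \<in> S \<Longrightarrow> dist y x < d \<Longrightarrow> dist (g y) (g x) < e"
      using g x e unfolding continuous_on_iff by meson
    obtain d' where d': "d' > 0" "ball x d' \<subseteq> S"
      using S x openE by blast
    have "norm (f y - f x - g x \<bullet> (y - x)) \<le> e * norm (y - x)" if y: "norm (y - x) < min d d'" for y
    proof -
      have yS: "y \<in> S" using y d' by (auto simp: dist_norm norm_minus_commute subset_iff)
      have "f y - f x - g x \<bullet> (y - x) \<le> (g y - g x) \<bullet> (y - x)"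
        using sub[OF yS x] by (simp add: inner_diff_left inner_diff_right)
      also have "\<dots> \<le> norm (g y - g x) * norm (y - x)" by (rule norm_cauchy_schwarz)
      also have "\<dots> \<le> e * norm (y - x)"
        using d(2)[OF yS] y by (intro mult_right_mono) (auto simp: dist_norm)
      finally show ?thesis using sub[OF x yS] by simp
    qed
    then show "\<exists>d>0. \<forall>y. norm (y - x) < d \<longrightarrow> norm (f y - f x - g x \<bullet> (y - x)) \<le> e * norm (y - x)"
      using d(1) d'(1) by (intro exI[of _ "min d d'"]) auto
  qed
  then show "(f has_derivative blinfun_apply (blinfun_inner_right (g x))) (at x)"
    by simp
qed

text \<open>
  The control \<open>u\<close> stays admissible for every other \<open>y\<close>, where by Cauchy--Schwarz it achieves at
  least \<open>u \<bullet> y + C (norm u)\<close>.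
\<close>

lemma optimal_control_subgradient:
  fixes l u y :: "real ^ 'm"
  assumes C: "continuous_on {0..1} C" and u: "norm u \<le> 1"
    and opt: "u \<bullet> l + C (norm u) = moderation_potential C l"
  shows "moderation_potential C l + u \<bullet> (y - l) \<le> moderation_potential C y"
proof -
  have "moderation_potential C l + u \<bullet> (y - l) = u \<bullet> y + C (norm u)"
    using opt by (simp add: inner_diff_right)
  also have "\<dots> \<le> norm u * norm y + C (norm u)"
    using norm_cauchy_schwarz by simp
  also have "\<dots> \<le> moderation_potential C y"
    unfolding moderation_potential_def using C u by (intro le_max_value) auto
  finally show ?thesis .
qed

corollary continuous_optimal_control_imp_continuously_differentiable:
  fixes u :: "real ^ 'm \<Rightarrow> real ^ 'm"
  assumes "continuous_on {0..1} C" "open S" "continuous_on S u"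
    and "\<And>l. l \<in> S \<Longrightarrow> norm (u l) \<le> 1"
    and "\<And>l. l \<in> S \<Longrightarrow> u l \<bullet> l + C (norm (u l)) = moderation_potential C l"
  shows "continuously_differentiable_on (moderation_potential C) S"
  using assms
  by (intro continuous_subgradient_imp_continuously_differentiable[of S u]
      optimal_control_subgradient) auto

section \<open>The square-root incentives\<close>

lemma continuous_on_C_mu: "continuous_on S (C_mu \<mu>)"
  unfolding C_mu_def by (intro continuous_intros)

lemma C_mu_lagrange_identity:
  assumes "\<bar>\<rho>\<bar> \<le> 1"
  shows "(\<rho> * s + C_mu \<mu> \<rho>)\<^sup>2 + (s * sqrt (1 - \<rho>\<^sup>2) - \<mu> * \<rho>)\<^sup>2 = \<mu>\<^sup>2 + s\<^sup>2"
proof -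
  define r where "r = sqrt (1 - \<rho>\<^sup>2)"
  have r: "r\<^sup>2 = 1 - \<rho>\<^sup>2" using assms unfolding r_def by (simp add: abs_square_le_1)
  have "(\<rho> * s + \<mu> * r)\<^sup>2 + (s * r - \<mu> * \<rho>)\<^sup>2 = (\<mu>\<^sup>2 + s\<^sup>2) * (\<rho>\<^sup>2 + r\<^sup>2)" by algebra
  then show ?thesis unfolding C_mu_def r_def[symmetric] using r by simp
qed

lemma C_mu_le:
  assumes "\<bar>\<rho>\<bar> \<le> 1"
  shows "\<rho> * s + C_mu \<mu> \<rho> \<le> sqrt (\<mu>\<^sup>2 + s\<^sup>2)"
proof (rule real_le_rsqrt)
  show "(\<rho> * s + C_mu \<mu> \<rho>)\<^sup>2 \<le> \<mu>\<^sup>2 + s\<^sup>2"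
    using C_mu_lagrange_identity[OF assms, of s \<mu>]
      zero_le_power2[of "s * sqrt (1 - \<rho>\<^sup>2) - \<mu> * \<rho>"] by linarith
qed

lemma divide_sqrt_le_one: "\<bar>s / sqrt (\<mu>\<^sup>2 + s\<^sup>2)\<bar> \<le> (1::real)"
proof (cases "\<mu>\<^sup>2 + s\<^sup>2 = 0")
  case False
  then have "sqrt (\<mu>\<^sup>2 + s\<^sup>2) > 0" by (simp add: less_le)
  moreover have "\<bar>s\<bar> \<le> sqrt (\<mu>\<^sup>2 + s\<^sup>2)" by (rule real_le_rsqrt) simp
  ultimately show ?thesis by (simp add: divide_le_eq_1)
qed simp

text \<open>The case \<open>\<mu> = s = 0\<close> is covered because \<open>0 / 0 = 0\<close>; there every \<open>\<rho>\<close> is optimal.\<close>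

lemma C_mu_attained:
  assumes "\<mu> \<ge> 0"
  defines "\<rho> \<equiv> \<lambda>s. s / sqrt (\<mu>\<^sup>2 + s\<^sup>2)"
  shows "\<rho> s * s + C_mu \<mu> (\<rho> s) = sqrt (\<mu>\<^sup>2 + s\<^sup>2)"
proof (cases "\<mu>\<^sup>2 + s\<^sup>2 = 0")
  case True
  then show ?thesis by (simp add: sum_power2_eq_zero_iff C_mu_def)
next
  case False
  then have pos: "\<mu>\<^sup>2 + s\<^sup>2 > 0" by (simp add: less_le)
  define R where "R = sqrt (\<mu>\<^sup>2 + s\<^sup>2)"
  have R: "R > 0" "R\<^sup>2 = \<mu>\<^sup>2 + s\<^sup>2" using pos unfolding R_def by auto
  have "(s / R)\<^sup>2 + (\<mu> / R)\<^sup>2 = R\<^sup>2 / R\<^sup>2"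
    unfolding R(2) power_divide by (simp only: add_divide_distrib add.commute)
  then have "1 - (s / R)\<^sup>2 = (\<mu> / R)\<^sup>2" using R(1) by simp
  then have "sqrt (1 - (s / R)\<^sup>2) = \<mu> / R" using R assms(1) by simp
  then have "s / R * s + C_mu \<mu> (s / R) = R\<^sup>2 / R"
    unfolding C_mu_def R(2) by (simp add: power2_eq_square add_divide_distrib)
  then show ?thesis unfolding \<rho>_def R_def[symmetric] using R(1) by (simp add: power2_eq_square)
qed

lemma max_value_C_mu:
  assumes "\<mu> \<ge> 0" "s \<ge> 0"
  shows "max_value (C_mu \<mu>) s = sqrt (\<mu>\<^sup>2 + s\<^sup>2)"
proof -
  have "s / sqrt (\<mu>\<^sup>2 + s\<^sup>2) \<in> {0..1}"
    using divide_sqrt_le_one[of s \<mu>] assms(2) by (simp add: abs_le_iff)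
  then have "max_value (C_mu \<mu>) s
      = s / sqrt (\<mu>\<^sup>2 + s\<^sup>2) * s + C_mu \<mu> (s / sqrt (\<mu>\<^sup>2 + s\<^sup>2))"
    by (rule max_value_eqI) (simp only: C_mu_attained[OF assms(1)], simp add: C_mu_le)
  then show ?thesis by (simp only: C_mu_attained[OF assms(1)])
qed

text \<open>
  Equality in Cauchy--Schwarz means \<open>s * sqrt (1 - \<rho>\<^sup>2) = \<mu> * \<rho>\<close>.  Multiplying the hypothesis
  by \<open>s\<close> and substituting makes it linear in \<open>\<rho>\<close>.
\<close>

lemma C_mu_maximizer_unique:
  assumes s: "s > 0" and \<rho>: "\<bar>\<rho>\<bar> \<le> 1" and eq: "\<rho> * s + C_mu \<mu> \<rho> = sqrt (\<mu>\<^sup>2 + s\<^sup>2)"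
  shows "\<rho> = s / sqrt (\<mu>\<^sup>2 + s\<^sup>2)"
proof -
  define R where "R = sqrt (\<mu>\<^sup>2 + s\<^sup>2)"
  have R: "R > 0" "R\<^sup>2 = \<mu>\<^sup>2 + s\<^sup>2" using s unfolding R_def by (auto intro: add_nonneg_pos)
  define r where "r = sqrt (1 - \<rho>\<^sup>2)"
  have sr: "s * r = \<mu> * \<rho>"
    using C_mu_lagrange_identity[OF \<rho>, of s \<mu>] eq R unfolding R_def[symmetric] r_def by simp
  have "\<rho> * s + \<mu> * r = R" using eq unfolding C_mu_def R_def r_def .
  then have "R * s = \<rho> * s\<^sup>2 + \<mu> * (s * r)" by (auto simp: power2_eq_square algebra_simps)
  also have "\<dots> = \<rho> * R\<^sup>2" unfolding sr R(2) by (simp add: power2_eq_square algebra_simps)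
  finally have "s = \<rho> * R" using R(1) by (simp add: power2_eq_square)
  then show ?thesis using R(1) unfolding R_def[symmetric] by simp
qed

lemma differentiable_sqrt:
  fixes f :: "real \<Rightarrow> real"
  assumes "f differentiable at x" "f x > 0"
  shows "(\<lambda>x. sqrt (f x)) differentiable at x"
proof (rule differentiable_compose[where f = sqrt])
  show "sqrt differentiable at (f x)"
    using DERIV_real_sqrt[OF assms(2)] unfolding real_differentiable_def by blast
qed (rule assms(1))

lemma moderation_incentive_C_mu:
  assumes \<mu>: "0 \<le> \<mu>" "\<mu> \<le> 1"
  shows "moderation_incentive (C_mu \<mu>)"
proof (rule moderation_incentiveI[where \<sigma> = "\<lambda>s. s / sqrt (\<mu>\<^sup>2 + s\<^sup>2)"])
  have pos: "\<mu>\<^sup>2 + s\<^sup>2 > 0" if "s > 0" for s using that by (auto intro: add_nonneg_pos)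
  show "continuous_on {0..1} (C_mu \<mu>)" by (rule continuous_on_C_mu)
  show "C_mu \<mu> ` {0..1} \<subseteq> {0..1}"
    using \<mu> by (auto simp: C_mu_def abs_square_le_1 intro!: mult_le_one)
  show "C_mu \<mu> differentiable_on {0<..<1}"
  proof (rule differentiable_at_imp_differentiable_on)
    fix s :: real assume "s \<in> {0<..<1}"
    then have "1 - s\<^sup>2 > 0" by (simp add: abs_square_less_1)
    then show "C_mu \<mu> differentiable at s"
      unfolding C_mu_def[abs_def] by (intro differentiable_sqrt derivative_intros)
  qed
  show "C_mu \<mu> 1 = 0" by (simp add: C_mu_def)
  show "mono_on {0<..} (\<lambda>s. s / sqrt (\<mu>\<^sup>2 + s\<^sup>2))"
  proof (rule mono_onI)
    fix s t :: real assume st: "s \<in> {0<..}" "t \<in> {0<..}" "s \<le> t"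
    have "(s * sqrt (\<mu>\<^sup>2 + t\<^sup>2))\<^sup>2 \<le> (t * sqrt (\<mu>\<^sup>2 + s\<^sup>2))\<^sup>2"
      using st power_mono[of s t 2]
      by (simp add: power_mult_distrib algebra_simps mult_left_mono)
    then have "s * sqrt (\<mu>\<^sup>2 + t\<^sup>2) \<le> t * sqrt (\<mu>\<^sup>2 + s\<^sup>2)"
      by (rule power2_le_imp_le) (use st in auto)
    then show "s / sqrt (\<mu>\<^sup>2 + s\<^sup>2) \<le> t / sqrt (\<mu>\<^sup>2 + t\<^sup>2)"
      using pos[of s] pos[of t] st by (simp add: frac_le_eq divide_le_eq le_divide_eq mult.commute)
  qed
  show "continuous_on {0<..} (\<lambda>s. s / sqrt (\<mu>\<^sup>2 + s\<^sup>2))"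
    using pos by (intro continuous_intros) force
  show "(\<lambda>s. s / sqrt (\<mu>\<^sup>2 + s\<^sup>2)) ` {0<..} \<subseteq> {0<..1}"
    using divide_sqrt_le_one[of _ \<mu>] pos by (force simp: abs_le_iff)
  show "(\<lambda>s. s / sqrt (\<mu>\<^sup>2 + s\<^sup>2)) differentiable_on
      ({0<..} \<inter> (\<lambda>s. s / sqrt (\<mu>\<^sup>2 + s\<^sup>2)) -` {0<..<1})"
  proof (rule differentiable_at_imp_differentiable_on)
    fix s :: real assume "s \<in> {0<..} \<inter> (\<lambda>s. s / sqrt (\<mu>\<^sup>2 + s\<^sup>2)) -` {0<..<1}"
    then have *: "\<mu>\<^sup>2 + s\<^sup>2 > 0" using pos by auto
    then have "(\<lambda>s. sqrt (\<mu>\<^sup>2 + s\<^sup>2)) differentiable at s"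
      by (intro differentiable_sqrt derivative_intros)
    moreover have "sqrt (\<mu>\<^sup>2 + s\<^sup>2) \<noteq> 0"
      unfolding real_sqrt_eq_0_iff using * by (rule less_imp_neq[symmetric])
    ultimately show "(\<lambda>s. s / sqrt (\<mu>\<^sup>2 + s\<^sup>2)) differentiable at s"
      by (intro differentiable_divide differentiable_ident)
  qed
  show "s / sqrt (\<mu>\<^sup>2 + s\<^sup>2) * s + C_mu \<mu> (s / sqrt (\<mu>\<^sup>2 + s\<^sup>2)) = max_value (C_mu \<mu>) s"
    if "s > 0" for s
    using that by (simp only: C_mu_attained[OF \<mu>(1)] max_value_C_mu[OF \<mu>(1)] less_imp_le)
  show "\<rho> = s / sqrt (\<mu>\<^sup>2 + s\<^sup>2)"
    if "s > 0" "\<rho> \<in> {0..1}" "\<rho> * s + C_mu \<mu> \<rho> = max_value (C_mu \<mu>) s" for s \<rho>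
    using that by (intro C_mu_maximizer_unique) (auto simp: max_value_C_mu[OF \<mu>(1)])
qed

lemma moderation_potential_C_mu:
  assumes "\<mu> \<ge> 0"
  shows "moderation_potential (C_mu \<mu>) = chi_mu \<mu>"
  using assms by (simp add: fun_eq_iff moderation_potential_def chi_mu_def max_value_C_mu)

text \<open>
  The optimal control \<open>l / \<chi>\<^sub>\<mu> l\<close> is continuous wherever the denominator does not vanish, that is
  except at \<open>\<mu> = 0\<close>, \<open>l = 0\<close>.
\<close>

lemma continuously_differentiable_chi_mu:
  fixes S :: "(real ^ 'm) set"
  assumes \<mu>: "\<mu> \<ge> 0" and S: "open S" and nz: "\<And>l. l \<in> S \<Longrightarrow> chi_mu \<mu> l \<noteq> 0"
  shows "continuously_differentiable_on (chi_mu \<mu>) S"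
proof -
  have norm_u: "norm (l /\<^sub>R chi_mu \<mu> l) = norm l / sqrt (\<mu>\<^sup>2 + (norm l)\<^sup>2)" for l :: "real ^ 'm"
    by (simp add: chi_mu_def divide_inverse)
  have "continuously_differentiable_on (moderation_potential (C_mu \<mu>)) S"
  proof (rule continuous_optimal_control_imp_continuously_differentiable[OF continuous_on_C_mu S])
    have "continuous_on S (chi_mu \<mu>)" unfolding chi_mu_def[abs_def] by (intro continuous_intros)
    then show "continuous_on S (\<lambda>l. l /\<^sub>R chi_mu \<mu> l)"
      using nz by (intro continuous_intros) auto
    fix l :: "real ^ 'm"
    show "norm (l /\<^sub>R chi_mu \<mu> l) \<le> 1"
      unfolding norm_u using divide_sqrt_le_one[of "norm l" \<mu>] by (simp add: abs_le_iff)
    have "(l /\<^sub>R chi_mu \<mu> l) \<bullet> l = norm l / sqrt (\<mu>\<^sup>2 + (norm l)\<^sup>2) * norm l"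
      by (simp add: chi_mu_def dot_square_norm power2_eq_square field_simps)
    then show "(l /\<^sub>R chi_mu \<mu> l) \<bullet> l + C_mu \<mu> (norm (l /\<^sub>R chi_mu \<mu> l)) = moderation_potential (C_mu \<mu>) l"
      unfolding norm_u
      by (simp only: C_mu_attained[OF \<mu>] moderation_potential_C_mu[OF \<mu>] chi_mu_def)
  qed
  then show ?thesis unfolding moderation_potential_C_mu[OF \<mu>] .
qed

lemma chi_mu_0: "chi_mu 0 = norm"
  by (simp add: fun_eq_iff chi_mu_def)

text \<open>
  Since the norm has a minimum at \<open>0\<close>, its derivative there could only be \<open>0\<close>, but it grows
  linearly.
\<close>

lemma norm_not_differentiable_at_0:
  fixes b :: "'a::real_normed_vector"
  assumes "b \<noteq> 0"
  shows "\<not> (norm :: 'a \<Rightarrow> real) differentiable (at 0)"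
proof
  assume "(norm :: 'a \<Rightarrow> real) differentiable (at 0)"
  then obtain D where D: "((norm :: 'a \<Rightarrow> real) has_derivative D) (at 0)"
    by (auto simp: differentiable_def)
  have "D = (\<lambda>h. 0)"
    using D by (rule has_derivative_local_min) auto
  then obtain d where d: "d > 0" "\<And>y. norm y < d \<Longrightarrow> norm y \<le> 1 / 2 * norm (y :: 'a)"
    using D unfolding has_derivative_at_alt by (auto dest!: spec[of _ "1 / 2"])
  show False
    using d(2)[of "(d / (2 * norm b)) *\<^sub>R b"] d(1) assms by simp
qed

section \<open>The quadratic incentive\<close>

lemma continuous_on_C_q: "continuous_on S C_q"
  unfolding C_q_def by (intro continuous_intros) auto

text \<open>
  Since \<open>\<rho> * s + C_q \<rho> = (1 + s\<^sup>2) / 2 - (\<rho> - s)\<^sup>2 / 2\<close>, maximising over \<open>[0,1]\<close> means projecting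
  \<open>s\<close> to \<open>[0,1]\<close>.  The loss of any other \<open>\<rho>\<close> is at least quadratic, which bounds the value and
  gives uniqueness of the maximiser at once.
\<close>

lemma C_q_gap:
  assumes "\<rho> \<le> 1"
  shows "\<rho> * s + C_q \<rho> + (\<rho> - min s 1)\<^sup>2 / 2 \<le> min s 1 * s + C_q (min s 1)"
proof (cases "s \<le> 1")
  case True
  then show ?thesis by (simp add: C_q_def power2_eq_square field_simps)
next
  case False
  have "(1 - \<rho>) * (s - 1) \<ge> 0" using assms False by (intro mult_nonneg_nonneg) auto
  then show ?thesis using False by (simp add: C_q_def power2_eq_square field_simps)
qed

lemma max_value_C_q:
  assumes "s \<ge> 0"
  shows "max_value C_q s = min s 1 * s + C_q (min s 1)"
proof (rule max_value_eqI)
  show "min s 1 \<in> {0..1}" using assms by auto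
  show "\<rho> * s + C_q \<rho> \<le> min s 1 * s + C_q (min s 1)" if "\<rho> \<in> {0..1}" for \<rho>
    using C_q_gap[of \<rho> s] zero_le_power2[of "\<rho> - min s 1"] that
    unfolding atLeastAtMost_iff by linarith
qed

lemma moderation_incentive_C_q: "moderation_incentive C_q"
proof (rule moderation_incentiveI[where \<sigma> = "\<lambda>s. min s 1"])
  show "continuous_on {0..1} C_q" by (rule continuous_on_C_q)
  show "C_q ` {0..1} \<subseteq> {0..1}"
  proof (rule image_subsetI)
    fix s :: real assume "s \<in> {0..1}"
    then have "s\<^sup>2 \<le> 1" by (simp add: abs_square_le_1)
    then show "C_q s \<in> {0..1}" by (auto simp: C_q_def intro: order_trans[OF _ zero_le_power2])
  qed
  show "C_q differentiable_on {0<..<1}"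
    unfolding C_q_def[abs_def] divide_inverse differentiable_on_def
    by (auto intro!: derivative_intros)
  show "C_q 1 = 0" by (simp add: C_q_def)
  show "mono_on {0<..} (\<lambda>s::real. min s 1)" by (auto intro!: mono_onI)
  show "continuous_on {0<..} (\<lambda>s::real. min s 1)" by (intro continuous_intros)
  show "(\<lambda>s::real. min s 1) ` {0<..} \<subseteq> {0<..1}" by auto
  have "(\<lambda>s::real. min s 1) differentiable_on {0<..<1}"
    unfolding differentiable_on_def
    by (auto intro: differentiable_transform_within[OF differentiable_ident zero_less_one])
  moreover have "{0<..} \<inter> (\<lambda>s::real. min s 1) -` {0<..<1} = {0<..<1}" by auto
  ultimately show "(\<lambda>s::real. min s 1) differentiable_on ({0<..} \<inter> (\<lambda>s. min s 1) -` {0<..<1})"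
    by simp
  show "min s 1 * s + C_q (min s 1) = max_value C_q s" if "s > 0" for s
    using that by (simp add: max_value_C_q)
  show "\<rho> = min s 1" if "s > 0" "\<rho> \<in> {0..1}" "\<rho> * s + C_q \<rho> = max_value C_q s" for s \<rho>
  proof -
    have "(\<rho> - min s 1)\<^sup>2 \<le> 0"
      using C_q_gap[of \<rho> s] that by (simp add: max_value_C_q)
    then show ?thesis by simp
  qed
qed

lemma moderation_potential_C_q: "moderation_potential C_q = chi_q"
  by (auto simp: fun_eq_iff moderation_potential_def chi_q_def max_value_C_q C_q_def min_def
      power2_eq_square field_simps)

text \<open>
  Dividing by \<open>max 1 (norm l)\<close> gives \<open>l\<close> the optimal norm \<open>min (norm l) 1\<close> while avoiding the
  singularity of \<open>l / norm l\<close> at the origin.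
\<close>

lemma continuously_differentiable_chi_q:
  "continuously_differentiable_on (chi_q :: real ^ 'm \<Rightarrow> real) UNIV"
proof -
  have norm_u: "norm (l /\<^sub>R max 1 (norm l)) = min (norm l) 1" for l :: "real ^ 'm"
    by (cases "l = 0") (auto simp: max_def min_def)
  have "continuously_differentiable_on (moderation_potential C_q :: real ^ 'm \<Rightarrow> real) UNIV"
  proof (rule continuous_optimal_control_imp_continuously_differentiable[OF continuous_on_C_q open_UNIV])
    show "continuous_on UNIV (\<lambda>l :: real ^ 'm. l /\<^sub>R max 1 (norm l))"
      by (intro continuous_intros) (auto simp: max_def)
    fix l :: "real ^ 'm"
    show "norm (l /\<^sub>R max 1 (norm l)) \<le> 1" unfolding norm_u by simp
    have "(l /\<^sub>R max 1 (norm l)) \<bullet> l = min (norm l) 1 * norm l"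
      by (cases "l = 0") (auto simp: dot_square_norm power2_eq_square max_def min_def)
    then show "(l /\<^sub>R max 1 (norm l)) \<bullet> l + C_q (norm (l /\<^sub>R max 1 (norm l))) = moderation_potential C_q l"
      unfolding norm_u by (simp add: moderation_potential_def max_value_C_q)
  qed
  then show ?thesis unfolding moderation_potential_C_q .
qed

section \<open>The proposition\<close>

theorem proposition1:
  "(\<forall>\<mu>. 0 \<le> \<mu> \<and> \<mu> \<le> 1 \<longrightarrow>
      moderation_incentive (C_mu \<mu>) \<and>
      (\<forall>l :: real ^ 'm. moderation_potential (C_mu \<mu>) l = chi_mu \<mu> l) \<and>
      (\<mu> > 0 \<longrightarrow>
         continuously_differentiable_on (chi_mu \<mu> :: real ^ 'm \<Rightarrow> real) UNIV \<and>
         (\<forall>l :: real ^ 'm. chi_mu \<mu> l > 0))) \<and>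
   continuously_differentiable_on (chi_mu 0 :: real ^ 'm \<Rightarrow> real) (UNIV - {0}) \<and>
   \<not> (chi_mu 0 :: real ^ 'm \<Rightarrow> real) differentiable (at 0) \<and>
   (\<forall>u :: real ^ 'm. norm u \<le> 1 \<longrightarrow> control_equation (C_mu 0) 0 u) \<and>
   moderation_incentive C_q \<and>
   (\<forall>l :: real ^ 'm. moderation_potential C_q l = chi_q l) \<and>
   continuously_differentiable_on (chi_q :: real ^ 'm \<Rightarrow> real) UNIV \<and>
   (\<forall>l :: real ^ 'm. chi_q l > 0)"
proof (intro conjI allI impI)
  fix \<mu> :: real and l :: "real ^ 'm"
  assume \<mu>: "0 \<le> \<mu> \<and> \<mu> \<le> 1"
  show "moderation_incentive (C_mu \<mu>)" using \<mu> by (simp add: moderation_incentive_C_mu)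
  show "moderation_potential (C_mu \<mu>) l = chi_mu \<mu> l" using \<mu> by (simp add: moderation_potential_C_mu)
next
  fix \<mu> :: real
  assume \<mu>: "\<mu> > 0"
  show pos: "chi_mu \<mu> l > 0" for l :: "real ^ 'm"
    using \<mu> by (auto simp: chi_mu_def intro: add_pos_nonneg)
  show "continuously_differentiable_on (chi_mu \<mu> :: real ^ 'm \<Rightarrow> real) UNIV"
    using \<mu> by (intro continuously_differentiable_chi_mu) (auto simp: less_imp_neq[OF pos, symmetric])
next
  show "continuously_differentiable_on (chi_mu 0 :: real ^ 'm \<Rightarrow> real) (UNIV - {0})"
    by (intro continuously_differentiable_chi_mu) (auto simp: chi_mu_0 open_delete)
  show "\<not> (chi_mu 0 :: real ^ 'm \<Rightarrow> real) differentiable (at 0)"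
    unfolding chi_mu_0 by (rule norm_not_differentiable_at_0[of 1]) (simp add: vec_eq_iff)
  show "control_equation (C_mu 0) 0 u" for u :: "real ^ 'm"
    by (simp add: control_equation_def moderation_potential_C_mu chi_mu_0 C_mu_def)
next
  show "moderation_incentive C_q" by (rule moderation_incentive_C_q)
  show "moderation_potential C_q l = chi_q l" for l :: "real ^ 'm"
    by (simp add: moderation_potential_C_q)
  show "continuously_differentiable_on (chi_q :: real ^ 'm \<Rightarrow> real) UNIV"
    by (rule continuously_differentiable_chi_q)
  show "chi_q l > 0" for l :: "real ^ 'm"
    using zero_le_power2[of "norm l"] by (auto simp: chi_q_def intro: add_pos_nonneg)
qed

end
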